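(* Let $Q$ be an acyclic quiver and let $M$ be a thin sincere representation of $Q$ over a field $K$. Then a minimal generating set of the stability space $\mathcal{D}(M)\subseteq\mathbb{R}^{Q_0}$ is given by $$\{e_i-e_j \mid i\to j \text{ is an arrow of } Q\},$$ where $(e_i)_{i\in Q_0}$ is the standard basis of $\mathbb{R}^{Q_0}$.
   Context: Quivers are finite, with vertex set $Q_0$ and arrow set $Q_1$; representations are finite-dimensional. The dimension vector of a representation $M=(M_i,\phi_\alpha)$ is $\underline{\dim} M=(\dim_K M_i)_{i\in Q_0}$. $M$ is thin if its composition factors are pairwise non-isomorphic, and sincere if $M_i\neq 0$ for all $i\in Q_0$. Let $\langle -,-\rangle$ be the standard inner product on $\mathbb{R}^{Q_0}$. For $\mathbf{v}\in\mathbb{R}^{Q_0}$, a non-zero representation $M$ is $\mathbf{v}$-semistable if $\langle\mathbf{v},\underline{\dim} M\rangle=0$ and $\langle \mathbf{v},\underline{\dim} L\rangle\leq 0$ for every proper subrepresentation $L$ of $M$. The stability space is $\mathcal{D}(M)=\{\mathbf{v}\in\mathbb{R}^{Q_0}\mid M\text{ is }\mathbf{v}\text{-semistable}\}$, a polyhedral cone. For a finite set $W$ of vectors, $\mathrm{Span}_{\geq 0}(W)$ is the set of all non-negative linear combinations of elements of $W$. $W$ is a minimal generating set of a cone $C$ if $\mathrm{Span}_{\geq 0}(W)=C$ and $W$ is minimal with respect to inclusion among sets with this property.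
   Formalization: The formal theorem assumes in addition that no arrow i→j is parallel to a directed path of length at least 2 and that for each arrow i→j some arrow from i to j acts by a nonzero map on M; the claim fails without either condition. *)

theory Defs
  imports "HOL-Analysis.Analysis" "Graph_Theory.Digraph"
begin

text \<open>
  Quivers are finite digraphs with parallel arrows and loops allowed. Vector spaces are subspaces
  of an arbitrary ambient space of type \<open>'m\<close> with scalar multiplication
  \<open>smul :: 'k \<Rightarrow> 'm \<Rightarrow> 'm\<close>. The ambient space need not have finite dimension. The values of
  the structure maps outside the space at the source of the arrow carry no meaning.
\<close>

record ('v, 'a, 'm) quiver_rep =
  rep_space :: "'v \<Rightarrow> 'm set"
  rep_map :: "'a \<Rightarrow> 'm \<Rightarrow> 'm"

definition linear_between ::
  "('k::field \<Rightarrow> 'm::ab_group_add \<Rightarrow> 'm) \<Rightarrow> 'm set \<Rightarrow> 'm set \<Rightarrow> ('m \<Rightarrow> 'm) \<Rightarrow> bool" where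
  "linear_between smul U W f \<longleftrightarrow>
     (\<forall>x\<in>U. f x \<in> W) \<and>
     (\<forall>x\<in>U. \<forall>y\<in>U. f (x + y) = f x + f y) \<and>
     (\<forall>c. \<forall>x\<in>U. f (smul c x) = smul c (f x))"

definition fin_dim_subspace ::
  "('k::field \<Rightarrow> 'm::ab_group_add \<Rightarrow> 'm) \<Rightarrow> 'm set \<Rightarrow> bool" where
  "fin_dim_subspace smul U \<longleftrightarrow> (\<exists>B. finite B \<and> U = module.span smul B)"

definition representation ::
  "('k::field \<Rightarrow> 'm::ab_group_add \<Rightarrow> 'm) \<Rightarrow> ('v, 'a) pre_digraph \<Rightarrow>
   ('v, 'a, 'm) quiver_rep \<Rightarrow> bool" where
  "representation smul Q M \<longleftrightarrow>
     (\<forall>i\<in>verts Q. fin_dim_subspace smul (rep_space M i)) \<and>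
     (\<forall>a\<in>arcs Q.
        linear_between smul (rep_space M (tail Q a)) (rep_space M (head Q a)) (rep_map M a))"

definition zero_rep :: "('v, 'a) pre_digraph \<Rightarrow> ('v, 'a, 'm::zero) quiver_rep \<Rightarrow> bool" where
  "zero_rep Q M \<longleftrightarrow> (\<forall>i\<in>verts Q. rep_space M i = {0})"

definition sincere :: "('v, 'a) pre_digraph \<Rightarrow> ('v, 'a, 'm::zero) quiver_rep \<Rightarrow> bool" where
  "sincere Q M \<longleftrightarrow> (\<forall>i\<in>verts Q. rep_space M i \<noteq> {0})"

definition subrep ::
  "('k::field \<Rightarrow> 'm::ab_group_add \<Rightarrow> 'm) \<Rightarrow> ('v, 'a) pre_digraph \<Rightarrow>
   ('v, 'a, 'm) quiver_rep \<Rightarrow> ('v, 'a, 'm) quiver_rep \<Rightarrow> bool" where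
  "subrep smul Q L M \<longleftrightarrow>
     representation smul Q L \<and>
     (\<forall>i\<in>verts Q. rep_space L i \<subseteq> rep_space M i) \<and>
     (\<forall>a\<in>arcs Q. \<forall>x\<in>rep_space L (tail Q a). rep_map L a x = rep_map M a x)"

definition proper_subrep ::
  "('k::field \<Rightarrow> 'm::ab_group_add \<Rightarrow> 'm) \<Rightarrow> ('v, 'a) pre_digraph \<Rightarrow>
   ('v, 'a, 'm) quiver_rep \<Rightarrow> ('v, 'a, 'm) quiver_rep \<Rightarrow> bool" where
  "proper_subrep smul Q L M \<longleftrightarrow>
     subrep smul Q L M \<and> (\<exists>i\<in>verts Q. rep_space L i \<noteq> rep_space M i)"

definition rep_hom ::
  "('k::field \<Rightarrow> 'm::ab_group_add \<Rightarrow> 'm) \<Rightarrow> ('v, 'a) pre_digraph \<Rightarrow>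
   ('v, 'a, 'm) quiver_rep \<Rightarrow> ('v, 'a, 'm) quiver_rep \<Rightarrow> ('v \<Rightarrow> 'm \<Rightarrow> 'm) \<Rightarrow> bool" where
  "rep_hom smul Q M N f \<longleftrightarrow>
     (\<forall>i\<in>verts Q. linear_between smul (rep_space M i) (rep_space N i) (f i)) \<and>
     (\<forall>a\<in>arcs Q. \<forall>x\<in>rep_space M (tail Q a).
        f (head Q a) (rep_map M a x) = rep_map N a (f (tail Q a) x))"

definition rep_iso ::
  "('k::field \<Rightarrow> 'm::ab_group_add \<Rightarrow> 'm) \<Rightarrow> ('v, 'a) pre_digraph \<Rightarrow>
   ('v, 'a, 'm) quiver_rep \<Rightarrow> ('v, 'a, 'm) quiver_rep \<Rightarrow> bool" where
  "rep_iso smul Q M N \<longleftrightarrow>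
     (\<exists>f. rep_hom smul Q M N f \<and>
        (\<forall>i\<in>verts Q. bij_betw (f i) (rep_space M i) (rep_space N i)))"

definition simple_rep ::
  "('k::field \<Rightarrow> 'm::ab_group_add \<Rightarrow> 'm) \<Rightarrow> ('v, 'a) pre_digraph \<Rightarrow>
   ('v, 'a, 'm) quiver_rep \<Rightarrow> bool" where
  "simple_rep smul Q S \<longleftrightarrow>
     representation smul Q S \<and> \<not> zero_rep Q S \<and>
     (\<forall>L. proper_subrep smul Q L S \<longrightarrow> zero_rep Q L)"

text \<open>
  \<open>S\<close> is a copy of the quotient \<open>L/N\<close>, i.e. the target of an epimorphism from \<open>L\<close> with
  kernel \<open>N\<close>. A copy exists inside the same ambient space, on vertexwise complements of
  \<open>N\<close> in \<open>L\<close>.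
\<close>

definition is_quotient ::
  "('k::field \<Rightarrow> 'm::ab_group_add \<Rightarrow> 'm) \<Rightarrow> ('v, 'a) pre_digraph \<Rightarrow>
   ('v, 'a, 'm) quiver_rep \<Rightarrow> ('v, 'a, 'm) quiver_rep \<Rightarrow> ('v, 'a, 'm) quiver_rep \<Rightarrow> bool" where
  "is_quotient smul Q S L N \<longleftrightarrow>
     representation smul Q S \<and> subrep smul Q N L \<and>
     (\<exists>f. rep_hom smul Q L S f \<and>
        (\<forall>i\<in>verts Q. f i ` rep_space L i = rep_space S i \<and>
                     {x \<in> rep_space L i. f i x = 0} = rep_space N i))"

text \<open>
  A chain \<open>0 = L\<^sub>0 \<subset> \<dots> \<subset> L\<^sub>n = M\<close> together with the list of its (simple) factors
  \<open>S\<^sub>k \<cong> L\<^sub>k\<^sub>+\<^sub>1 / L\<^sub>k\<close>.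
\<close>

definition composition_series ::
  "('k::field \<Rightarrow> 'm::ab_group_add \<Rightarrow> 'm) \<Rightarrow> ('v, 'a) pre_digraph \<Rightarrow>
   ('v, 'a, 'm) quiver_rep \<Rightarrow> ('v, 'a, 'm) quiver_rep list \<Rightarrow>
   ('v, 'a, 'm) quiver_rep list \<Rightarrow> bool" where
  "composition_series smul Q M Ls Ss \<longleftrightarrow>
     length Ls = Suc (length Ss) \<and>
     (\<forall>L\<in>set Ls. subrep smul Q L M) \<and>
     zero_rep Q (Ls ! 0) \<and> Ls ! length Ss = M \<and>
     (\<forall>k<length Ss. is_quotient smul Q (Ss ! k) (Ls ! Suc k) (Ls ! k) \<and>
                    simple_rep smul Q (Ss ! k))"

text \<open>
  By Jordan-Hoelder the condition does not depend on the chosen composition series, and every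
  finite-dimensional representation has one.
\<close>

definition thin ::
  "('k::field \<Rightarrow> 'm::ab_group_add \<Rightarrow> 'm) \<Rightarrow> ('v, 'a) pre_digraph \<Rightarrow>
   ('v, 'a, 'm) quiver_rep \<Rightarrow> bool" where
  "thin smul Q M \<longleftrightarrow>
     (\<exists>Ls Ss. composition_series smul Q M Ls Ss \<and>
        (\<forall>k<length Ss. \<forall>l<length Ss. k \<noteq> l \<longrightarrow> \<not> rep_iso smul Q (Ss ! k) (Ss ! l)))"

text \<open>
  From here on the vertex set is all of the finite type \<open>'v\<close>, so that \<open>real ^ 'v\<close>
  is the space of real vectors indexed by the vertices.
\<close>

definition dim_vector ::
  "('k::field \<Rightarrow> 'm::ab_group_add \<Rightarrow> 'm) \<Rightarrow> ('v::finite, 'a, 'm) quiver_rep \<Rightarrow> real ^ 'v" where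
  "dim_vector smul M = (\<chi> i. real (vector_space.dim smul (rep_space M i)))"

definition semistable ::
  "('k::field \<Rightarrow> 'm::ab_group_add \<Rightarrow> 'm) \<Rightarrow> ('v::finite, 'a) pre_digraph \<Rightarrow>
   real ^ 'v \<Rightarrow> ('v, 'a, 'm) quiver_rep \<Rightarrow> bool" where
  "semistable smul Q v M \<longleftrightarrow>
     \<not> zero_rep Q M \<and> v \<bullet> dim_vector smul M = 0 \<and>
     (\<forall>L. proper_subrep smul Q L M \<longrightarrow> v \<bullet> dim_vector smul L \<le> 0)"

definition stability_space ::
  "('k::field \<Rightarrow> 'm::ab_group_add \<Rightarrow> 'm) \<Rightarrow> ('v::finite, 'a) pre_digraph \<Rightarrow>
   ('v, 'a, 'm) quiver_rep \<Rightarrow> (real ^ 'v) set" where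
  "stability_space smul Q M = {v. semistable smul Q v M}"

text \<open>Meant for finite \<open>W\<close>. The span of the empty set is \<open>{0}\<close>.\<close>

definition nonneg_span :: "'b::real_vector set \<Rightarrow> 'b set" where
  "nonneg_span W = {\<Sum>w\<in>W. c w *\<^sub>R w | c. \<forall>w\<in>W. 0 \<le> c w}"

definition minimal_generating_set :: "'b::real_vector set \<Rightarrow> 'b set \<Rightarrow> bool" where
  "minimal_generating_set W C \<longleftrightarrow>
     finite W \<and> nonneg_span W = C \<and> (\<forall>W'. W' \<subset> W \<longrightarrow> nonneg_span W' \<noteq> C)"

end

theory Submission
  imports Defs
begin

text \<open>
  The composition factors of \<open>M\<close> are simple. As \<open>Q\<close> is acyclic, a simple representation
  is a line placed at one vertex (\<open>simple_rep_is_line_at_vertex\<close>), and the vertex determines it up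
  to isomorphism (\<open>simple_reps_at_same_vertex_iso\<close>). Pairwise non-isomorphic factors therefore
  sit at distinct vertices, so sincerity makes every \<open>M\<^sub>i\<close> a line
  (\<open>thin_sincere_imp_lines\<close>).

  Subspaces of a line are trivial, so a subrepresentation \<open>L\<close> of \<open>M\<close> is given by its
  support, and \<open>dim L\<close> is the indicator vector of the support. If between any two adjacent
  vertices some arrow acts by a non-zero map, the supports are exactly the vertex sets that are closed
  under arrows. Hence \<open>\<D>(M)\<close> consists of the vectors \<open>v\<close> with coordinate sum \<open>0\<close> and
  non-positive coordinate sum over each closed set (\<open>stability_space_eq_closed_set_cone\<close>).

  Each \<open>e\<^sub>i - e\<^sub>j\<close> lies in this cone. Suppose that some \<open>v\<close> in the cone is not a non-negative
  combination of them. A hyperplane separates it: there is \<open>w\<close> with \<open>w \<bullet> v > 0\<close> that is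
  weakly increasing along arrows. But then the upper level sets of \<open>w\<close> are closed, and slicing
  \<open>w \<bullet> v\<close> by these level sets (\<open>sum_mult_nonpos_of_level_sets\<close>) gives
  \<open>w \<bullet> v \<le> 0\<close>.

  No generator can be dropped. For an arrow \<open>i \<rightarrow> j\<close>, take the set of all vertices that can be
  reached from \<open>i\<close> without using an arrow \<open>i \<rightarrow> j\<close>. Absence of a bypass keeps \<open>j\<close> out of
  it, so its indicator is positive on \<open>e\<^sub>i - e\<^sub>j\<close>, and it is non-positive on all other
  generators (\<open>arrow_vector_notin_span_of_others\<close>).
\<close>

section \<open>Finitely generated cones\<close>

lemma nonneg_span_eq_convex_cone_hull:
  fixes W :: "'b::real_vector set"
  assumes "finite W"
  shows "nonneg_span W = convex_cone hull W"
proof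
  show "nonneg_span W \<subseteq> convex_cone hull W"
  proof
    fix x assume "x \<in> nonneg_span W"
    then obtain c where c: "\<forall>w\<in>W. 0 \<le> c w" and x: "x = (\<Sum>w\<in>W. c w *\<^sub>R w)"
      by (auto simp: nonneg_span_def)
    have "(\<Sum>w\<in>V. c w *\<^sub>R w) \<in> convex_cone hull W" if "finite V" "V \<subseteq> W" for V
      using that
    proof (induction V rule: finite_induct)
      case empty
      show ?case by (simp add: convex_cone_hull_contains_0)
    next
      case (insert w V)
      then show ?case
        using c by (simp add: convex_cone_hull_add convex_cone_hull_mul hull_inc)
    qed
    then show "x \<in> convex_cone hull W"
      using assms x by blast
  qed
  have "convex_cone (nonneg_span W)"
    unfolding convex_cone_iff
  proof (intro conjI ballI allI impI)
    show "0 \<in> nonneg_span W"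
      unfolding nonneg_span_def by (rule CollectI, rule exI[of _ "\<lambda>_. 0"]) simp
  next
    fix x y assume "x \<in> nonneg_span W" "y \<in> nonneg_span W"
    then obtain c d where "\<forall>w\<in>W. 0 \<le> c w" "x = (\<Sum>w\<in>W. c w *\<^sub>R w)"
      and "\<forall>w\<in>W. 0 \<le> d w" "y = (\<Sum>w\<in>W. d w *\<^sub>R w)"
      by (auto simp: nonneg_span_def)
    then show "x + y \<in> nonneg_span W"
      unfolding nonneg_span_def
      by (intro CollectI exI[of _ "\<lambda>w. c w + d w"]) (simp add: scaleR_left_distrib sum.distrib)
  next
    fix x and a :: real assume "x \<in> nonneg_span W" "0 \<le> a"
    then obtain c where "\<forall>w\<in>W. 0 \<le> c w" "x = (\<Sum>w\<in>W. c w *\<^sub>R w)"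
      by (auto simp: nonneg_span_def)
    with \<open>0 \<le> a\<close> show "a *\<^sub>R x \<in> nonneg_span W"
      unfolding nonneg_span_def
      by (intro CollectI exI[of _ "\<lambda>w. a * c w"]) (simp add: scaleR_sum_right)
  qed
  moreover have "W \<subseteq> nonneg_span W"
  proof
    fix w assume "w \<in> W"
    have "(\<Sum>u\<in>W. (if u = w then 1 else 0) *\<^sub>R u) = (\<Sum>u\<in>W. if u = w then u else 0)"
      by (rule sum.cong) auto
    also have "\<dots> = w"
      using assms \<open>w \<in> W\<close> by simp
    finally show "w \<in> nonneg_span W"
      unfolding nonneg_span_def
      by (intro CollectI exI[of _ "\<lambda>u. if u = w then 1 else 0"]) simp
  qed
  ultimately show "convex_cone hull W \<subseteq> nonneg_span W"
    by (intro hull_minimal)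
qed

text \<open>
  Farkas' lemma, from separation by a hyperplane: a finitely generated cone is closed and convex.
\<close>

lemma separating_functional_nonneg_span:
  fixes W :: "'b::euclidean_space set"
  assumes "finite W" and "v \<notin> nonneg_span W"
  obtains w where "0 < w \<bullet> v" and "\<forall>g\<in>W. w \<bullet> g \<le> 0"
proof -
  let ?C = "convex_cone hull W"
  have "v \<notin> ?C"
    using assms nonneg_span_eq_convex_cone_hull by blast
  then obtain a b where av: "a \<bullet> v < b" and aC: "\<forall>x\<in>?C. b < a \<bullet> x"
    using separating_hyperplane_closed_point[of ?C v] convex_convex_cone_hull
      closed_convex_cone_hull[OF \<open>finite W\<close>] by blast
  have "b < 0"
    using aC convex_cone_hull_contains_0[of W] by force
  have "0 \<le> a \<bullet> g" if "g \<in> W" for g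
  proof (rule ccontr)
    assume neg: "\<not> 0 \<le> a \<bullet> g"
    \<comment> \<open>Otherwise a suitable multiple of \<open>g\<close> lies on the hyperplane.\<close>
    have "0 \<le> b / (a \<bullet> g)"
      using \<open>b < 0\<close> neg by (simp add: divide_nonpos_nonpos)
    then have "(b / (a \<bullet> g)) *\<^sub>R g \<in> ?C"
      by (simp add: convex_cone_hull_mul hull_inc that)
    then have "b < a \<bullet> ((b / (a \<bullet> g)) *\<^sub>R g)"
      using aC by blast
    then show False using neg by simp
  qed
  then show thesis
    using that[of "- a"] av \<open>b < 0\<close> by force
qed

section \<open>Vertex sets closed under arrows\<close>

text \<open>
  Summation by parts over the values of \<open>w\<close>: lowering the largest value of \<open>w\<close> to the
  second largest subtracts from the sum a non-negative multiple of the sum of \<open>v\<close> over the top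
  level set, so the sum does not decrease. Each level set stays as it is or becomes empty. Once
  \<open>w\<close> is constant, the sum is a multiple of \<open>sum v I = 0\<close>.
\<close>

lemma sum_mult_nonpos_of_level_sets:
  fixes v w :: "'i \<Rightarrow> real"
  assumes "finite I" and "sum v I = 0"
    and "\<And>s. (\<Sum>i\<in>{i\<in>I. s \<le> w i}. v i) \<le> 0"
  shows "(\<Sum>i\<in>I. w i * v i) \<le> 0"
  using assms(3)
proof (induction "card (w ` I)" arbitrary: w rule: less_induct)
  case less
  show ?case
  proof (cases "card (w ` I) \<le> 1")
    case True
    then have "\<exists>c. \<forall>i\<in>I. w i = c"
      using card_le_Suc0_iff_eq[of "w ` I"] \<open>finite I\<close> by (metis One_nat_def finite_imageI imageI)
    then obtain c where "\<forall>i\<in>I. w i = c" by blast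
    then have "(\<Sum>i\<in>I. w i * v i) = c * sum v I"
      by (simp add: sum_distrib_left)
    with \<open>sum v I = 0\<close> show ?thesis by simp
  next
    case False
    define m where "m = Max (w ` I)"
    define W where "W = w ` I - {m}"
    define m' where "m' = Max W"
    define w' where "w' = (\<lambda>i. min (w i) m')"
    have "w ` I \<noteq> {}" using False by auto
    have le_m: "w i \<le> m" if "i \<in> I" for i
      using \<open>finite I\<close> that by (simp add: m_def)
    have mI: "m \<in> w ` I"
      unfolding m_def using \<open>w ` I \<noteq> {}\<close> \<open>finite I\<close> by (intro Max_in) auto
    have "finite W" using \<open>finite I\<close> by (simp add: W_def)
    have card_W: "card W < card (w ` I)"
      unfolding W_def using mI \<open>finite I\<close> by (intro card_Diff1_less) auto
    have "W \<noteq> {}"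
      using False mI \<open>finite I\<close> unfolding W_def
      by (metis One_nat_def card.empty card.insert finite.emptyI insert_Diff insert_absorb
          insert_not_empty le_refl)
    then have "m' \<in> W" using \<open>finite W\<close> by (simp add: m'_def)
    then have "m' < m" using le_m by (force simp: W_def)
    have le_m': "w i \<le> m'" if "i \<in> I" "w i \<noteq> m" for i
      using that \<open>finite W\<close> by (simp add: m'_def W_def)
    have "w' ` I \<subseteq> W"
    proof
      fix y assume "y \<in> w' ` I"
      then obtain i where i: "i \<in> I" "y = min (w i) m'" by (auto simp: w'_def)
      show "y \<in> W"
      proof (cases "w i = m")
        case True
        then show ?thesis using i \<open>m' < m\<close> \<open>m' \<in> W\<close> by simp
      next
        case False
        then have "y = w i" using i le_m' by simp
        then show ?thesis using False i by (simp add: W_def)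
      qed
    qed
    then have smaller: "card (w' ` I) < card (w ` I)"
      using card_W card_mono[OF \<open>finite W\<close>] by (meson le_less_trans)
    have levels: "(\<Sum>i\<in>{i\<in>I. s \<le> w' i}. v i) \<le> 0" for s
    proof (cases "s \<le> m'")
      case True
      then have "{i\<in>I. s \<le> w' i} = {i\<in>I. s \<le> w i}" by (auto simp: w'_def)
      then show ?thesis using less.prems by simp
    next
      case False
      then have "{i\<in>I. s \<le> w' i} = {}" by (auto simp: w'_def)
      then show ?thesis by (simp only: sum.empty)
    qed
    have "w i * v i = w' i * v i + (if m \<le> w i then (m - m') * v i else 0)" if "i \<in> I" for i
    proof (cases "w i = m")
      case True
      then show ?thesis using \<open>m' < m\<close> by (simp add: w'_def algebra_simps)
    next
      case False
      then show ?thesis using le_m'[OF that] le_m[OF that] by (simp add: w'_def)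
    qed
    then have "(\<Sum>i\<in>I. w i * v i)
        = (\<Sum>i\<in>I. w' i * v i) + (\<Sum>i\<in>I. if m \<le> w i then (m - m') * v i else 0)"
      by (simp add: sum.distrib)
    also have "(\<Sum>i\<in>I. if m \<le> w i then (m - m') * v i else 0)
        = (m - m') * (\<Sum>i\<in>{i\<in>I. m \<le> w i}. v i)"
      using \<open>finite I\<close> by (auto simp: sum.inter_filter sum_distrib_left intro!: sum.cong)
    also have "\<dots> \<le> 0"
      using \<open>m' < m\<close> less.prems by (simp add: mult_nonneg_nonpos)
    finally show ?thesis
      using less.hyps[OF smaller levels] by linarith
  qed
qed

text \<open>
  The generators depend on the quiver only through its set of pairs of adjacent vertices: parallel
  arrows give the same vector.
\<close>

definition arrow_vectors :: "('v::finite \<times> 'v) set \<Rightarrow> (real ^ 'v) set" where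
  "arrow_vectors E = {axis i 1 - axis j 1 | i j. (i, j) \<in> E}"

lemma finite_arrow_vectors: "finite (arrow_vectors (E :: ('v::finite \<times> 'v) set))"
proof -
  have "arrow_vectors E = (\<lambda>(i, j). axis i 1 - axis j 1) ` E"
    by (auto simp: arrow_vectors_def)
  then show ?thesis by simp
qed

definition closed_set_cone :: "('v::finite \<times> 'v) set \<Rightarrow> (real ^ 'v) set" where
  "closed_set_cone E =
     {v. (\<Sum>i\<in>UNIV. v $ i) = 0 \<and> (\<forall>A. E `` A \<subseteq> A \<longrightarrow> (\<Sum>i\<in>A. v $ i) \<le> 0)}"

lemma sum_axis_diff:
  fixes A :: "'v::finite set"
  shows "(\<Sum>k\<in>A. (axis i 1 - axis j 1 :: real ^ 'v) $ k)
           = of_bool (i \<in> A) - of_bool (j \<in> A)"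
proof -
  have "(\<Sum>k\<in>A. (axis i 1 :: real ^ 'v) $ k) = of_bool (i \<in> A)" for i
    by (simp add: axis_def of_bool_def)
  then show ?thesis by (simp add: sum_subtractf)
qed

text \<open>
  Sums of coordinates over vertex sets are what the two sides share: closedness says that the sum of
  \<open>e\<^sub>i - e\<^sub>j\<close> over the set is never \<open>1\<close>, and a functional that is non-positive on all
  \<open>e\<^sub>i - e\<^sub>j\<close> is layered into indicators of closed sets.
\<close>

lemma nonneg_span_arrow_vectors:
  "nonneg_span (arrow_vectors E) = closed_set_cone (E :: ('v::finite \<times> 'v) set)"
proof
  have "convex_cone (closed_set_cone E)"
    unfolding convex_cone_iff closed_set_cone_def
    by (auto simp: sum.distrib simp flip: sum_distrib_left
        intro!: add_nonpos_nonpos mult_nonneg_nonpos)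
  moreover have "arrow_vectors E \<subseteq> closed_set_cone E"
  proof
    fix g assume "g \<in> arrow_vectors E"
    then obtain i j where ij: "(i, j) \<in> E" and g: "g = axis i 1 - axis j 1"
      by (auto simp: arrow_vectors_def)
    have "\<forall>A. E `` A \<subseteq> A \<longrightarrow> i \<in> A \<longrightarrow> j \<in> A"
      using ij by blast
    then show "g \<in> closed_set_cone E"
      unfolding closed_set_cone_def g
      by (auto simp: sum_axis_diff of_bool_def simp del: vector_minus_component)
  qed
  ultimately show "nonneg_span (arrow_vectors E) \<subseteq> closed_set_cone E"
    unfolding nonneg_span_eq_convex_cone_hull[OF finite_arrow_vectors] by (intro hull_minimal)
next
  show "closed_set_cone E \<subseteq> nonneg_span (arrow_vectors E)"
  proof (rule ccontr)
    assume "\<not> closed_set_cone E \<subseteq> nonneg_span (arrow_vectors E)"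
    then obtain v where v: "v \<in> closed_set_cone E" "v \<notin> nonneg_span (arrow_vectors E)"
      by blast
    obtain w where pos: "0 < w \<bullet> v" and le: "\<forall>g\<in>arrow_vectors E. w \<bullet> g \<le> 0"
      using separating_functional_nonneg_span[OF finite_arrow_vectors v(2)] .
    have mono: "w $ i \<le> w $ j" if "(i, j) \<in> E" for i j
    proof -
      have "axis i 1 - axis j 1 \<in> arrow_vectors E"
        using that by (auto simp: arrow_vectors_def)
      then have "w \<bullet> (axis i 1 - axis j 1) \<le> 0" using le by blast
      then show ?thesis by (simp add: inner_diff_right inner_axis)
    qed
    have "(\<Sum>i\<in>UNIV. w $ i * v $ i) \<le> 0"
    proof (rule sum_mult_nonpos_of_level_sets)
      show "(\<Sum>i\<in>UNIV. v $ i) = 0" using v(1) by (simp add: closed_set_cone_def)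
    next
      fix s
      have "E `` {i \<in> UNIV. s \<le> w $ i} \<subseteq> {i \<in> UNIV. s \<le> w $ i}"
        using mono by force
      then show "(\<Sum>i\<in>{i \<in> UNIV. s \<le> w $ i}. v $ i) \<le> 0"
        using v(1) unfolding closed_set_cone_def by blast
    qed simp
    then show False using pos by (simp add: inner_vec_def)
  qed
qed

text \<open>
  The indicator of the set of vertices reachable from \<open>i\<close> along the other edges witnesses
  irredundancy. That set leaves out \<open>j\<close>, since a path from \<open>i\<close> to \<open>j\<close> along the other edges
  would have a first step to some vertex other than \<open>j\<close> and then go on, i.e. be a bypass.
\<close>

lemma arrow_vector_notin_span_of_others:
  fixes E :: "('v::finite \<times> 'v) set"
  assumes "i \<noteq> j" and "(i, j) \<notin> E O E\<^sup>+"
    and "W \<subseteq> arrow_vectors E" and "axis i 1 - axis j 1 \<notin> W"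
  shows "axis i 1 - axis j 1 \<notin> nonneg_span W"
proof
  let ?F = "E - {(i, j)}"
  define A where "A = {k. (i, k) \<in> ?F\<^sup>*}"
  define \<phi> :: "real ^ 'v" where "\<phi> = (\<chi> k. of_bool (k \<in> A))"
  have \<phi>: "\<phi> \<bullet> (axis k 1 - axis l 1) = of_bool (k \<in> A) - of_bool (l \<in> A)" for k l
    by (simp add: \<phi>_def inner_diff_right inner_axis)
  have "i \<in> A" by (simp add: A_def)
  have "j \<notin> A"
  proof
    assume "j \<in> A"
    then have "(i, j) \<in> ?F\<^sup>*" by (simp add: A_def)
    then obtain k where k: "(i, k) \<in> ?F" "(k, j) \<in> ?F\<^sup>*"
      using \<open>i \<noteq> j\<close> by (meson converse_rtranclE)
    then have "(k, j) \<in> E\<^sup>*"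
      using rtrancl_mono[of ?F E] by blast
    moreover have "k \<noteq> j" using k(1) by blast
    ultimately have "(k, j) \<in> E\<^sup>+" by (simp add: rtrancl_eq_or_trancl)
    then show False using k(1) assms(2) by blast
  qed
  have "\<phi> \<bullet> g \<le> 0" if "g \<in> W" for g
  proof -
    obtain k l where kl: "(k, l) \<in> E" "g = axis k 1 - axis l 1"
      using subsetD[OF assms(3) \<open>g \<in> W\<close>] by (auto simp: arrow_vectors_def)
    then have "(k, l) \<in> ?F" using that assms(4) by auto
    then have "k \<in> A \<Longrightarrow> l \<in> A"
      unfolding A_def by (auto intro: rtrancl_into_rtrancl)
    then show ?thesis using kl by (auto simp: \<phi>)
  qed
  then have "convex_cone hull W \<subseteq> {x. \<phi> \<bullet> x \<le> 0}"
    by (intro hull_minimal convex_cone_halfspace_le) auto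
  moreover have "finite W"
    using assms(3) finite_arrow_vectors finite_subset by blast
  moreover assume "axis i 1 - axis j 1 \<in> nonneg_span W"
  ultimately have "\<phi> \<bullet> (axis i 1 - axis j 1) \<le> 0"
    using nonneg_span_eq_convex_cone_hull by blast
  then show False using \<open>i \<in> A\<close> \<open>j \<notin> A\<close> by (simp add: \<phi>)
qed

section \<open>Simple representations of an acyclic quiver\<close>

context vector_space
begin

lemma fin_dim_subspace_imp_subspace: "fin_dim_subspace scale U \<Longrightarrow> subspace U"
  by (auto simp: fin_dim_subspace_def)

lemma fin_dim_subspace_zero: "fin_dim_subspace scale {0}"
  unfolding fin_dim_subspace_def by (rule exI[of _ "{}"]) simp

lemma fin_dim_subspace_line: "fin_dim_subspace scale (span {x})"
  unfolding fin_dim_subspace_def by blast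

lemma subspace_of_line:
  assumes "subspace U" and "U \<subseteq> span {x}"
  shows "U = {0} \<or> U = span {x}"
proof (cases "U = {0}")
  case False
  then obtain y where y: "y \<in> U" "y \<noteq> 0"
    using subspace_0[OF assms(1)] by blast
  then obtain c where c: "y = scale c x"
    using assms(2) by (auto simp: span_singleton)
  with y have "c \<noteq> 0" by auto
  then have "x = scale (inverse c) y"
    using c by simp
  then have "x \<in> U"
    using y assms(1) by (simp add: subspace_scale)
  then show ?thesis
    using assms span_minimal[of "{x}" U] by blast
qed simp

lemma dim_line: "x \<noteq> 0 \<Longrightarrow> dim (span {x}) = 1"
  using dim_eq_card_independent[of "{x}"] by (simp add: dim_span independent_insert)

lemma dim_zero_space: "dim {0} = 0"
  using dim_eq_card[of "{}" "{0}"] by (simp add: independent_empty)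

lemma linear_between_zero:
  assumes "linear_between scale U W f" and "0 \<in> U"
  shows "f 0 = 0"
proof -
  have "f (scale 0 0) = scale 0 (f 0)"
    using assms unfolding linear_between_def by blast
  then show ?thesis by simp
qed

lemma subrep_of_stable_family:
  assumes "Defs.representation scale Q M"
    and "\<And>i. i \<in> verts Q \<Longrightarrow> fin_dim_subspace scale (U i)"
    and "\<And>i. i \<in> verts Q \<Longrightarrow> U i \<subseteq> rep_space M i"
    and "\<And>a x. a \<in> arcs Q \<Longrightarrow> x \<in> U (tail Q a) \<Longrightarrow> rep_map M a x \<in> U (head Q a)"
    and "wf_digraph Q"
  shows "subrep scale Q (M\<lparr>rep_space := U\<rparr>) M"
proof -
  have "linear_between scale (U (tail Q a)) (U (head Q a)) (rep_map M a)" if "a \<in> arcs Q" for a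
  proof -
    have "linear_between scale (rep_space M (tail Q a)) (rep_space M (head Q a)) (rep_map M a)"
      using assms(1) that by (simp add: Defs.representation_def)
    moreover have "U (tail Q a) \<subseteq> rep_space M (tail Q a)"
      using assms(3,5) that by (simp add: wf_digraph.tail_in_verts)
    ultimately show ?thesis
      using assms(4)[OF that] unfolding linear_between_def by blast
  qed
  then show ?thesis
    using assms(2,3) by (simp add: subrep_def Defs.representation_def)
qed

text \<open>
  Acyclicity gives the support of the representation a vertex with no arrow to another vertex of the
  support. Any line at that vertex is a subrepresentation, hence everything.
\<close>

lemma simple_rep_is_line_at_vertex:
  fixes Q :: "('v, 'e) pre_digraph"
  assumes "fin_digraph Q" and "acyclic (arcs_ends Q)" and "simple_rep scale Q S"
  obtains i x where "i \<in> verts Q" and "x \<noteq> 0" and "rep_space S i = span {x}"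
    and "\<forall>j\<in>verts Q. j \<noteq> i \<longrightarrow> rep_space S j = {0}"
proof -
  interpret fin_digraph Q by fact
  have rep: "Defs.representation scale Q S" and nz: "\<not> zero_rep Q S"
    and simple: "\<And>L. proper_subrep scale Q L S \<Longrightarrow> zero_rep Q L"
    using assms(3) by (auto simp: simple_rep_def)
  have sub: "subspace (rep_space S i)" if "i \<in> verts Q" for i
    using rep that fin_dim_subspace_imp_subspace by (simp add: Defs.representation_def)
  have lin: "linear_between scale (rep_space S (tail Q a)) (rep_space S (head Q a)) (rep_map S a)"
    if "a \<in> arcs Q" for a
    using rep that by (simp add: Defs.representation_def)
  let ?supp = "{i \<in> verts Q. rep_space S i \<noteq> {0}}"
  have "wf ((arcs_ends Q)\<inverse>)"
    by (intro finite_acyclic_wf_converse assms(2)) (simp add: arcs_ends_def)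
  moreover obtain i0 where "i0 \<in> ?supp"
    using nz by (auto simp: zero_rep_def)
  ultimately obtain i where i: "i \<in> ?supp"
    and sink: "\<And>j. (j, i) \<in> (arcs_ends Q)\<inverse> \<Longrightarrow> j \<notin> ?supp"
    by (rule wfE_min) blast
  have sink_zero: "rep_space S (head Q a) = {0}" if "a \<in> arcs Q" "tail Q a = i" for a
    using sink[of "head Q a"] that by (auto simp: arcs_ends_def arc_to_ends_def)
  obtain x where x: "x \<in> rep_space S i" "x \<noteq> 0"
    using i sub subspace_0 by blast
  define U where "U = (\<lambda>j. if j = i then span {x} else {0})"
  let ?L = "S\<lparr>rep_space := U\<rparr>"
  have "subrep scale Q ?L S"
  proof (rule subrep_of_stable_family[OF rep])
    show "U j \<subseteq> rep_space S j" if "j \<in> verts Q" for j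
      using x sub[OF that] subspace_0[OF sub[OF that]] span_minimal[of "{x}"]
      by (auto simp: U_def)
    show "rep_map S a y \<in> U (head Q a)" if a: "a \<in> arcs Q" and y: "y \<in> U (tail Q a)" for a y
    proof -
      have "rep_map S a y = 0"
      proof (cases "tail Q a = i")
        case True
        have "y \<in> rep_space S (tail Q a)"
          using y True x sub i span_minimal[of "{x}" "rep_space S i"] by (auto simp: U_def)
        then show ?thesis
          using lin[OF a] sink_zero[OF a True] by (auto simp: linear_between_def)
      next
        case False
        then have "y = 0" using y by (simp add: U_def)
        then show ?thesis
          using linear_between_zero[OF lin[OF a]] sub a by (simp add: subspace_0)
      qed
      then show ?thesis by (simp add: U_def span_zero)
    qed
  qed (auto simp: U_def fin_dim_subspace_line fin_dim_subspace_zero wf_digraph_axioms)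
  moreover have "\<not> zero_rep Q ?L"
    using i x span_base[of x "{x}"] by (auto simp: zero_rep_def U_def)
  ultimately have "rep_space S j = U j" if "j \<in> verts Q" for j
    using simple[of ?L] that by (auto simp: proper_subrep_def)
  then show thesis
    using that[of i x] i x by (simp add: U_def)
qed

lemma lines_linear_bij:
  assumes "x \<noteq> 0" and "y \<noteq> 0"
  obtains f where "linear_between scale (span {x}) (span {y}) f"
    and "bij_betw f (span {x}) (span {y})"
proof -
  \<comment> \<open>The coordinate of \<open>z\<close> with respect to \<open>x\<close> is unique because \<open>x \<noteq> 0\<close>.\<close>
  define f where "f = (\<lambda>z. scale (THE c. z = scale c x) y)"
  have f: "f (scale c x) = scale c y" for c
    using assms(1) by (simp add: f_def)
  have "linear_between scale (span {x}) (span {y}) f"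
    by (auto simp: linear_between_def span_singleton f simp flip: scale_left_distrib)
  moreover have "bij_betw f (span {x}) (span {y})"
    using assms(2) by (auto simp: bij_betw_def inj_on_def span_singleton f image_image)
  ultimately show thesis by (rule that)
qed

text \<open>
  Without loops, every arrow starts or ends at a vertex where the representations vanish, so all
  structure maps are zero and any isomorphism of the two lines is compatible with them.
\<close>

lemma simple_reps_at_same_vertex_iso:
  fixes Q :: "('v, 'e) pre_digraph"
  assumes "wf_digraph Q" and "acyclic (arcs_ends Q)"
    and "Defs.representation scale Q S" and "Defs.representation scale Q T"
    and "x \<noteq> 0" "rep_space S i = span {x}" "\<forall>j\<in>verts Q. j \<noteq> i \<longrightarrow> rep_space S j = {0}"
    and "y \<noteq> 0" "rep_space T i = span {y}" "\<forall>j\<in>verts Q. j \<noteq> i \<longrightarrow> rep_space T j = {0}"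
  shows "rep_iso scale Q S T"
proof -
  interpret wf_digraph Q by fact
  have no_loop: "tail Q a \<noteq> head Q a" if "a \<in> arcs Q" for a
  proof -
    have "(tail Q a, head Q a) \<in> (arcs_ends Q)\<^sup>+"
      using that by (intro r_into_trancl) (simp add: arcs_ends_def arc_to_ends_def)
    then show ?thesis
      using assms(2) unfolding acyclic_def by force
  qed
  have vanish: "rep_map R a z = 0"
    if a: "a \<in> arcs Q" and z: "z \<in> rep_space R (tail Q a)" and R: "Defs.representation scale Q R"
      and R0: "\<forall>j\<in>verts Q. j \<noteq> i \<longrightarrow> rep_space R j = {0}"
    for R :: "('v, 'e, 'b) quiver_rep" and a z
  proof -
    have lin: "linear_between scale (rep_space R (tail Q a)) (rep_space R (head Q a)) (rep_map R a)"
      using R a by (simp add: Defs.representation_def)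
    show ?thesis
    proof (cases "tail Q a = i")
      case True
      then have "rep_space R (head Q a) = {0}" using R0 a no_loop[OF a] by simp
      then show ?thesis using lin z unfolding linear_between_def by blast
    next
      case False
      then have "z = 0" using R0 a z by simp
      then show ?thesis using linear_between_zero[OF lin] z by simp
    qed
  qed
  obtain g where g: "linear_between scale (span {x}) (span {y}) g" "bij_betw g (span {x}) (span {y})"
    using lines_linear_bij[OF \<open>x \<noteq> 0\<close> \<open>y \<noteq> 0\<close>] .
  define f where "f = (\<lambda>j. if j = i then g else (\<lambda>_. 0))"
  have lin_bij: "linear_between scale (rep_space S j) (rep_space T j) (f j) \<and>
      bij_betw (f j) (rep_space S j) (rep_space T j)" if "j \<in> verts Q" for j
  proof (cases "j = i")
    case True
    then show ?thesis using g assms(6,9) by (simp add: f_def)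
  next
    case False
    then have "rep_space S j = {0}" "rep_space T j = {0}" "f j = (\<lambda>_. 0)"
      using that assms(7,10) by (simp_all add: f_def)
    then show ?thesis by (simp add: linear_between_def bij_betw_def)
  qed
  have "f (head Q a) (rep_map S a z) = rep_map T a (f (tail Q a) z)"
    if a: "a \<in> arcs Q" and z: "z \<in> rep_space S (tail Q a)" for a z
  proof -
    have ends: "tail Q a \<in> verts Q" "head Q a \<in> verts Q"
      using a by simp_all
    have "0 \<in> rep_space S (head Q a)"
      using assms(3) ends subspace_0 fin_dim_subspace_imp_subspace
      unfolding Defs.representation_def by blast
    then have "f (head Q a) 0 = 0"
      using linear_between_zero[of _ "rep_space T (head Q a)"] lin_bij[OF ends(2)] by blast
    moreover have "f (tail Q a) z \<in> rep_space T (tail Q a)"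
      using lin_bij[OF ends(1)] z unfolding linear_between_def by blast
    ultimately show ?thesis
      using vanish[OF a z assms(3,7)] vanish[OF a _ assms(4,10)] by simp
  qed
  then show ?thesis
    unfolding rep_iso_def rep_hom_def using lin_bij by blast
qed

text \<open>
  Along a composition series the space at vertex \<open>i\<close> grows only at a step whose factor sits at
  \<open>i\<close>. There is at most one such step. It starts from \<open>0\<close>, so \<open>M\<^sub>i\<close> is \<open>0\<close> or isomorphic to
  the line in the factor.
\<close>

lemma thin_sincere_imp_lines:
  fixes Q :: "('v, 'e) pre_digraph"
  assumes "fin_digraph Q" and "acyclic (arcs_ends Q)"
    and "thin scale Q M" and "sincere Q M" and i: "i \<in> verts Q"
  obtains x where "x \<noteq> 0" and "rep_space M i = span {x}"
proof -
  interpret fin_digraph Q by fact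
  obtain Ls Ss where series: "composition_series scale Q M Ls Ss"
    and noniso: "\<And>k l. k < length Ss \<Longrightarrow> l < length Ss \<Longrightarrow> k \<noteq> l \<Longrightarrow>
                   \<not> rep_iso scale Q (Ss ! k) (Ss ! l)"
    using assms(3) unfolding thin_def by blast
  let ?n = "length Ss"
  define P where "P = (\<lambda>k. rep_space (Ls ! k) i)"
  have simple: "simple_rep scale Q (Ss ! k)" if "k < ?n" for k
    using series that by (simp add: composition_series_def)
  have "\<exists>j x. x \<noteq> 0 \<and> rep_space (Ss ! k) j = span {x} \<and>
               (\<forall>l\<in>verts Q. l \<noteq> j \<longrightarrow> rep_space (Ss ! k) l = {0})" if "k < ?n" for k
    using simple_rep_is_line_at_vertex[OF assms(1,2) simple[OF that]] by metis
  then obtain p s where s: "\<And>k. k < ?n \<Longrightarrow> s k \<noteq> 0"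
    and line: "\<And>k. k < ?n \<Longrightarrow> rep_space (Ss ! k) (p k) = span {s k}"
    and zero: "\<And>k. k < ?n \<Longrightarrow> \<forall>l\<in>verts Q. l \<noteq> p k \<longrightarrow> rep_space (Ss ! k) l = {0}"
    by metis
  have p_inj: "k = l" if "k < ?n" "l < ?n" "p k = p l" for k l
  proof (rule ccontr)
    assume "k \<noteq> l"
    have "rep_iso scale Q (Ss ! k) (Ss ! l)"
    proof (rule simple_reps_at_same_vertex_iso[OF wf_digraph_axioms assms(2)])
      show "Defs.representation scale Q (Ss ! k)" "Defs.representation scale Q (Ss ! l)"
        using simple that by (auto simp: simple_rep_def)
      show "s k \<noteq> 0" "rep_space (Ss ! k) (p k) = span {s k}"
        "\<forall>j\<in>verts Q. j \<noteq> p k \<longrightarrow> rep_space (Ss ! k) j = {0}"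
        by (fact s[OF that(1)] line[OF that(1)] zero[OF that(1)])+
      show "s l \<noteq> 0" "rep_space (Ss ! l) (p k) = span {s l}"
        "\<forall>j\<in>verts Q. j \<noteq> p k \<longrightarrow> rep_space (Ss ! l) j = {0}"
        unfolding that(3) by (fact s[OF that(2)] line[OF that(2)] zero[OF that(2)])+
    qed
    then show False using noniso \<open>k \<noteq> l\<close> that by blast
  qed
  have step: "\<exists>f. linear_between scale (P (Suc k)) (rep_space (Ss ! k) i) f \<and>
                f ` P (Suc k) = rep_space (Ss ! k) i \<and> {x \<in> P (Suc k). f x = 0} = P k"
    if k: "k < ?n" for k
  proof -
    have "is_quotient scale Q (Ss ! k) (Ls ! Suc k) (Ls ! k)"
      using series k by (simp add: composition_series_def)
    then obtain f where "rep_hom scale Q (Ls ! Suc k) (Ss ! k) f"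
      and "\<forall>i\<in>verts Q. f i ` rep_space (Ls ! Suc k) i = rep_space (Ss ! k) i \<and>
             {x \<in> rep_space (Ls ! Suc k) i. f i x = 0} = rep_space (Ls ! k) i"
      unfolding is_quotient_def by blast
    then show ?thesis
      unfolding rep_hom_def P_def by (intro exI[of _ "f i"]) (simp add: i)
  qed
  have const: "P (Suc k) = P k" if k: "k < ?n" "p k \<noteq> i" for k
  proof -
    have factor: "rep_space (Ss ! k) i = {0}"
      using zero[OF k(1)] i k(2) by simp
    obtain f :: "'b \<Rightarrow> 'b" where "f ` P (Suc k) = {0}" and ker: "{x \<in> P (Suc k). f x = 0} = P k"
      using step[OF k(1)] unfolding factor by blast
    then have "\<forall>x\<in>P (Suc k). f x = 0" by blast
    then show ?thesis using ker by blast
  qed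
  have const_on: "P b = P a" if "a \<le> b" "\<forall>k. a \<le> k \<and> k < b \<longrightarrow> P (Suc k) = P k" for a b
    using that
  proof (induction b rule: dec_induct)
    case (step n)
    then show ?case by (metis less_Suc_eq)
  qed simp
  have P0: "P 0 = {0}" and Pn: "P ?n = rep_space M i"
    using series i by (auto simp: composition_series_def zero_rep_def P_def)
  have "rep_space M i \<noteq> {0}"
    using assms(4) i by (simp add: sincere_def)
  then have "\<exists>k<?n. p k = i"
    using const_on[of 0 ?n] const P0 Pn by (metis le0)
  then obtain k where k: "k < ?n" "p k = i" by blast
  have other: "P (Suc l) = P l" if "l < ?n" "l \<noteq> k" for l
    using const[OF that(1)] p_inj[OF that(1) k(1)] that(2) k(2) by metis
  have "P k = P 0"
    by (rule const_on) (use other k(1) in simp_all)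
  then have Pk: "P k = {0}" using P0 by simp
  have "P ?n = P (Suc k)"
    by (rule const_on) (use other k(1) in simp_all)
  then have PSk: "P (Suc k) = rep_space M i" using Pn by simp
  have factor: "rep_space (Ss ! k) i = span {s k}"
    using line[OF k(1)] unfolding k(2) .
  obtain f where lin: "linear_between scale (rep_space M i) (span {s k}) f"
    and onto: "f ` rep_space M i = span {s k}" and ker: "{x \<in> rep_space M i. f x = 0} = {0}"
    using step[OF k(1)] unfolding Pk PSk factor by (elim exE conjE) (rule that)
  have "subrep scale Q M M"
    using series unfolding composition_series_def
    by (metis lessI nth_mem)
  then have sub: "subspace (rep_space M i)"
    using i fin_dim_subspace_imp_subspace by (simp add: subrep_def Defs.representation_def)
  obtain x where x: "x \<in> rep_space M i" "f x = s k"
    using onto span_base[of "s k" "{s k}"] by (metis imageE singletonI)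
  have "x \<noteq> 0"
    using x s[OF k(1)] linear_between_zero[OF lin subspace_0[OF sub]] by auto
  moreover have "rep_space M i = span {x}"
  proof
    show "span {x} \<subseteq> rep_space M i"
      using x sub by (simp add: span_minimal)
    show "rep_space M i \<subseteq> span {x}"
    proof
      fix y assume y: "y \<in> rep_space M i"
      then have "f y \<in> span {s k}" using onto by blast
      then obtain c where c: "f y = scale c (s k)" by (auto simp: span_singleton)
      have diff: "y + scale (- c) x \<in> rep_space M i"
        by (intro subspace_add[OF sub] subspace_scale[OF sub] y x(1))
      have "f (y + scale (- c) x) = f y + f (scale (- c) x)"
        using lin y subspace_scale[OF sub x(1)] unfolding linear_between_def by blast
      also have "f (scale (- c) x) = scale (- c) (f x)"
        using lin x(1) unfolding linear_between_def by blast
      finally have "f (y + scale (- c) x) = 0"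
        using c x by simp
      then have "y + scale (- c) x = 0"
        using diff ker by blast
      then have "y = scale c x" by simp
      then show "y \<in> span {x}" by (auto simp: span_singleton)
    qed
  qed
  ultimately show thesis by (rule that)
qed

section \<open>The stability space\<close>

text \<open>
  Subrepresentations correspond to closed sets by taking supports: closedness of a support comes from
  the acting arrows, and the restriction of \<open>M\<close> to a closed set is a subrepresentation. The set
  \<open>UNIV\<close> is the support of \<open>M\<close> itself, where semistability demands equality.
\<close>

lemma stability_space_eq_closed_set_cone:
  fixes Q :: "('v::finite, 'e) pre_digraph"
  assumes "wf_digraph Q" and "verts Q = UNIV" and "Defs.representation scale Q M"
    and lines: "\<And>i. \<exists>x. x \<noteq> 0 \<and> rep_space M i = span {x}"
    and act: "\<forall>a\<in>arcs Q. \<exists>b\<in>arcs Q. tail Q b = tail Q a \<and> head Q b = head Q a \<and>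
                (\<exists>x\<in>rep_space M (tail Q b). rep_map M b x \<noteq> 0)"
  shows "stability_space scale Q M = closed_set_cone (arcs_ends Q)"
proof -
  have M_nz: "rep_space M i \<noteq> {0}" and M_dim: "dim (rep_space M i) = 1" for i
  proof -
    obtain x where x: "x \<noteq> 0" "rep_space M i = span {x}"
      using lines[of i] by blast
    show "dim (rep_space M i) = 1"
      unfolding x(2) by (rule dim_line[OF x(1)])
    show "rep_space M i \<noteq> {0}"
      using x span_base[of x "{x}"] by blast
  qed
  have M_dim_vec: "v \<bullet> dim_vector scale M = (\<Sum>i\<in>UNIV. v $ i)" for v
    by (simp add: inner_vec_def dim_vector_def M_dim)
  have sub_cases: "rep_space L i = {0} \<or> rep_space L i = rep_space M i"
    if "subrep scale Q L M" for L i
  proof -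
    have "fin_dim_subspace scale (rep_space L i)" "rep_space L i \<subseteq> rep_space M i"
      using that assms(2) by (auto simp: subrep_def Defs.representation_def)
    moreover obtain x where "rep_space M i = span {x}"
      using lines[of i] by blast
    ultimately show ?thesis
      using subspace_of_line[of "rep_space L i" x] fin_dim_subspace_imp_subspace by metis
  qed
  have L_dim_vec: "v \<bullet> dim_vector scale L = (\<Sum>i | rep_space L i \<noteq> {0}. v $ i)"
    if "subrep scale Q L M" for L v
  proof -
    have "dim (rep_space L i) = of_bool (rep_space L i \<noteq> {0})" for i
    proof (cases "rep_space L i = {0}")
      case True
      then show ?thesis by (simp add: dim_zero_space)
    next
      case False
      then have "rep_space L i = rep_space M i" using sub_cases[OF that] by blast
      then show ?thesis using False M_dim[of i] by simp
    qed
    then have "v \<bullet> dim_vector scale L = (\<Sum>i\<in>UNIV. if rep_space L i \<noteq> {0} then v $ i else 0)"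
      unfolding inner_vec_def dim_vector_def by (intro sum.cong) (simp_all add: of_bool_def)
    then show ?thesis
      by (simp add: sum.If_cases)
  qed
  have supp_closed: "arcs_ends Q `` {i. rep_space L i \<noteq> {0}} \<subseteq> {i. rep_space L i \<noteq> {0}}"
    if L: "subrep scale Q L M" for L
  proof
    fix j assume "j \<in> arcs_ends Q `` {i. rep_space L i \<noteq> {0}}"
    then obtain a where a: "a \<in> arcs Q" "head Q a = j" "rep_space L (tail Q a) \<noteq> {0}"
      by (auto simp: arcs_ends_def arc_to_ends_def)
    then obtain b x where b: "b \<in> arcs Q" "tail Q b = tail Q a" "head Q b = j"
      and x: "x \<in> rep_space M (tail Q b)" "rep_map M b x \<noteq> 0"
      using act by blast
    \<comment> \<open>A line that meets \<open>L\<close> non-trivially lies in \<open>L\<close>, so \<open>b\<close> acts non-trivially on \<open>L\<close>.\<close>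
    have xL: "x \<in> rep_space L (tail Q b)"
      using sub_cases[OF L, of "tail Q b"] a(3) b(2) x(1) by simp
    then have "rep_map L b x \<in> rep_space L j" "rep_map L b x = rep_map M b x"
      using L b unfolding subrep_def Defs.representation_def linear_between_def by blast+
    then show "j \<in> {i. rep_space L i \<noteq> {0}}"
      using x(2) by auto
  qed
  have realise: "\<exists>L. subrep scale Q L M \<and> {i. rep_space L i \<noteq> {0}} = A"
    if A: "arcs_ends Q `` A \<subseteq> A" for A
  proof -
    define U where "U = (\<lambda>i. if i \<in> A then rep_space M i else {0})"
    have zero_in: "0 \<in> rep_space M i" for i
    proof -
      obtain x where "rep_space M i = span {x}"
        using lines[of i] by blast
      then show ?thesis by (simp add: span_zero)
    qed
    have lin: "linear_between scale (rep_space M (tail Q a)) (rep_space M (head Q a)) (rep_map M a)"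
      if "a \<in> arcs Q" for a
      using assms(3) that by (simp add: Defs.representation_def)
    have "subrep scale Q (M\<lparr>rep_space := U\<rparr>) M"
    proof (rule subrep_of_stable_family[OF assms(3)])
      have "fin_dim_subspace scale (rep_space M i)" for i
        using assms(2,3) by (simp add: Defs.representation_def)
      then show "fin_dim_subspace scale (U i)" for i
        using fin_dim_subspace_zero by (simp add: U_def)
      show "U i \<subseteq> rep_space M i" for i
        using zero_in by (simp add: U_def)
      show "rep_map M a x \<in> U (head Q a)" if a: "a \<in> arcs Q" and x: "x \<in> U (tail Q a)" for a x
      proof (cases "tail Q a \<in> A")
        case True
        have "(tail Q a, head Q a) \<in> arcs_ends Q"
          using a by (simp add: arcs_ends_def arc_to_ends_def)
        then have "head Q a \<in> A" using A True by (meson Image_iff subsetD)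
        moreover have "x \<in> rep_space M (tail Q a)"
          using True x by (simp add: U_def)
        then have "rep_map M a x \<in> rep_space M (head Q a)"
          using lin[OF a] unfolding linear_between_def by blast
        ultimately show ?thesis by (simp add: U_def)
      next
        case False
        then have "x = 0" using x by (simp add: U_def)
        then have "rep_map M a x = 0"
          using linear_between_zero[OF lin[OF a] zero_in] by simp
        then show ?thesis using zero_in by (simp add: U_def)
      qed
    qed (fact assms(1))
    moreover have "{i. rep_space (M\<lparr>rep_space := U\<rparr>) i \<noteq> {0}} = A"
      using M_nz by (auto simp: U_def)
    ultimately show ?thesis by blast
  qed
  have "\<not> zero_rep Q M"
    using M_nz assms(2) by (simp add: zero_rep_def)
  then have semistable_iff: "semistable scale Q v M \<longleftrightarrow> (\<Sum>i\<in>UNIV. v $ i) = 0 \<and>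
      (\<forall>L. proper_subrep scale Q L M \<longrightarrow> (\<Sum>i | rep_space L i \<noteq> {0}. v $ i) \<le> 0)" for v
    using L_dim_vec by (auto simp: semistable_def M_dim_vec proper_subrep_def)
  have "semistable scale Q v M \<longleftrightarrow> v \<in> closed_set_cone (arcs_ends Q)" for v
  proof
    assume "semistable scale Q v M"
    then have total: "(\<Sum>i\<in>UNIV. v $ i) = 0"
      and proper: "\<And>L. proper_subrep scale Q L M \<Longrightarrow> (\<Sum>i | rep_space L i \<noteq> {0}. v $ i) \<le> 0"
      by (auto simp: semistable_iff)
    have "(\<Sum>i\<in>A. v $ i) \<le> 0" if A: "arcs_ends Q `` A \<subseteq> A" for A
    proof (cases "A = UNIV")
      case True
      then show ?thesis using total by simp
    next
      case False
      obtain L where L: "subrep scale Q L M" "{i. rep_space L i \<noteq> {0}} = A"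
        using realise[OF A] by blast
      moreover obtain i where "i \<notin> A" using False by blast
      ultimately have "rep_space L i \<noteq> rep_space M i"
        using M_nz by blast
      then have "proper_subrep scale Q L M"
        using L(1) assms(2) by (auto simp: proper_subrep_def)
      then show ?thesis using proper L(2) by blast
    qed
    then show "v \<in> closed_set_cone (arcs_ends Q)"
      using total by (simp add: closed_set_cone_def)
  next
    assume "v \<in> closed_set_cone (arcs_ends Q)"
    then show "semistable scale Q v M"
      using supp_closed by (auto simp: semistable_iff closed_set_cone_def proper_subrep_def)
  qed
  then show ?thesis by (auto simp: stability_space_def)
qed

end

theorem proposition1p1:
  fixes smul :: "'k::field \<Rightarrow> 'm::ab_group_add \<Rightarrow> 'm"
    and Q :: "('v::finite, 'a) pre_digraph"
    and M :: "('v, 'a, 'm) quiver_rep"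
  assumes "vector_space smul"
    and "fin_digraph Q" and "verts Q = UNIV"
    and "acyclic (arcs_ends Q)"
    and "representation smul Q M"
    and "thin smul Q M" and "sincere Q M"
    and no_bypass: "\<forall>a\<in>arcs Q. (tail Q a, head Q a) \<notin> arcs_ends Q O (arcs_ends Q)\<^sup>+"
    and arrows_act: "\<forall>a\<in>arcs Q. \<exists>b\<in>arcs Q. tail Q b = tail Q a \<and> head Q b = head Q a \<and>
                       (\<exists>x\<in>rep_space M (tail Q b). rep_map M b x \<noteq> 0)"
  shows "minimal_generating_set
           {axis (tail Q a) 1 - axis (head Q a) (1::real) | a. a \<in> arcs Q}
           (stability_space smul Q M)"
proof -
  interpret vector_space smul by fact
  interpret fin_digraph Q by fact
  let ?E = "arcs_ends Q"
  have E: "(i, j) \<in> ?E \<longleftrightarrow> (\<exists>a\<in>arcs Q. tail Q a = i \<and> head Q a = j)" for i j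
    by (auto simp: arcs_ends_def arc_to_ends_def)
  have generators: "{axis (tail Q a) 1 - axis (head Q a) (1::real) | a. a \<in> arcs Q}
      = arrow_vectors ?E"
    by (auto simp: arrow_vectors_def E)
  have lines: "\<exists>x. x \<noteq> 0 \<and> rep_space M i = span {x}" for i
  proof -
    have "i \<in> verts Q" using assms(3) by simp
    then obtain x where "x \<noteq> 0" "rep_space M i = span {x}"
      by (rule thin_sincere_imp_lines[OF assms(2,4,6,7)])
    then show ?thesis by (intro exI conjI)
  qed
  have space: "stability_space smul Q M = nonneg_span (arrow_vectors ?E)"
    unfolding nonneg_span_arrow_vectors
    by (rule stability_space_eq_closed_set_cone[OF wf_digraph_axioms assms(3,5) lines arrows_act])
  have "nonneg_span W \<noteq> nonneg_span (arrow_vectors ?E)" if W: "W \<subset> arrow_vectors ?E" for W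
  proof -
    obtain i j where ij: "(i, j) \<in> ?E" "axis i 1 - axis j 1 \<notin> W"
      using W by (auto simp: arrow_vectors_def)
    then have "i \<noteq> j"
      using assms(4) unfolding acyclic_def by blast
    moreover have "(i, j) \<notin> ?E O ?E\<^sup>+"
      using ij(1) no_bypass unfolding E by blast
    ultimately have "axis i 1 - axis j 1 \<notin> nonneg_span W"
      using arrow_vector_notin_span_of_others ij W by blast
    moreover have "axis i 1 - axis j 1 \<in> nonneg_span (arrow_vectors ?E)"
      unfolding nonneg_span_eq_convex_cone_hull[OF finite_arrow_vectors]
      by (rule hull_inc) (use ij(1) in \<open>auto simp: arrow_vectors_def\<close>)
    ultimately show ?thesis by blast
  qed
  then show ?thesis
    unfolding minimal_generating_set_def generators space
    by (simp add: finite_arrow_vectors)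
qed

end
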